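(* Suppose there is a constant $G$ such that $|\nabla f_t(x)|\le G$ for all $x\in\Theta$ and all $t\in\mathbb{Z}_{>0}$, and there is $\mu>0$ such that for all $t\in\mathbb{Z}_{\ge0}$ and $x,y\in\mathbb{R}^n$, $$f_t(y)\ge f_t(x)+\nabla f_t(x)^T(y-x)+\frac{\mu}{2}|y-x|^2 .$$ If the stepsize is chosen as $\alpha_t=\frac{P}{\mu t}$, then the static regret of the online random coordinate descent algorithm satisfies $$R_T^s\le\frac{PG^2}{2\mu}(1+\log T).$$
   Context: For each $t\in\mathbb{Z}_{\ge0}$, $f_t:\mathbb{R}^n\to\mathbb{R}$ is convex and continuously differentiable; $\Theta\subseteq\mathbb{R}^n$ is a non-empty closed convex set with Euclidean projection $\Pi_\Theta$; $|\cdot|$ is the Euclidean norm. The decision variable is partitioned into $P$ blocks, $x=(x_{(1)},\ldots,x_{(P)})$, $x_{(p)}\in\mathbb{R}^{n_p}$, $\sum_{p=1}^P n_p=n$, and $\nabla_{(p)}f_t$ denotes the $p$-th block of the gradient. Online random coordinate descent algorithm: start from $x_0\in\Theta$. At each time $t$ select $i_t\in\{1,\ldots,P\}$ uniformly at random (probability $1/P$ each), independently of all previous selections, and set $x_{t+1}=\Pi_\Theta\big(x_t-\alpha_tU_t\nabla f_t(x_t)\big)$, where $\alpha_t>0$ is the stepsize and $U_t$ is the block-diagonal matrix whose $i_t$-th diagonal block is the identity and whose other blocks are zero. (The stepsize formula concerns $t\ge1$; $\alpha_0>0$ is arbitrary.) The static regret is $R_T^s=\sum_{t=1}^T\mathbb{E}[f_t(x_t)]-\min_{x\in\Theta}\sum_{t=1}^T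 f_t(x)$. *)

theory Defs
  imports "HOL-Probability.Probability"
begin

text \<open>
  The division of the coordinates into blocks is a map \<open>blk\<close> sending each coordinate to the number
  of the block it belongs to. \<open>block_selector blk p\<close> is the block-diagonal matrix with the identity
  in the \<open>p\<close>-th diagonal block and zeros elsewhere.
\<close>

definition block_selector :: "('n::finite \<Rightarrow> nat) \<Rightarrow> nat \<Rightarrow> real ^ 'n ^ 'n" where
  "block_selector blk p = (\<chi> k l. if k = l \<and> blk k = p then 1 else 0)"

text \<open>
  The iterates for one realisation \<open>s\<close> of the sequence of selected blocks; \<open>g t\<close> is the gradient
  of the loss at time \<open>t\<close>. On a non-empty closed convex set, \<^const>\<open>closest_point\<close> is the
  Euclidean projection.
\<close>

primrec orcd ::
  "(real ^ 'n) set \<Rightarrow> ('n::finite \<Rightarrow> nat) \<Rightarrow> (nat \<Rightarrow> real) \<Rightarrow> (nat \<Rightarrow> real ^ 'n \<Rightarrow> real ^ 'n) \<Rightarrow>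
    real ^ 'n \<Rightarrow> (nat \<Rightarrow> nat) \<Rightarrow> nat \<Rightarrow> real ^ 'n"
where
  "orcd \<Theta> blk \<alpha> g x0 s 0 = x0"
| "orcd \<Theta> blk \<alpha> g x0 s (Suc t) =
    closest_point \<Theta>
      (orcd \<Theta> blk \<alpha> g x0 s t
        - \<alpha> t *\<^sub>R (block_selector blk (s t) *v g t (orcd \<Theta> blk \<alpha> g x0 s t)))"

text \<open>
  The \<^const>\<open>Least\<close> term is the minimum over \<open>\<Theta>\<close> proper, not an infimum: it is specified only if
  the minimum is attained.
\<close>

definition static_regret ::
  "'w measure \<Rightarrow> (nat \<Rightarrow> 'a \<Rightarrow> real) \<Rightarrow> 'a set \<Rightarrow> (nat \<Rightarrow> 'w \<Rightarrow> 'a) \<Rightarrow> nat \<Rightarrow> real" where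
  "static_regret M f \<Theta> X T =
    (\<Sum>t=1..T. \<integral>\<omega>. f t (X t \<omega>) \<partial>M) - (LEAST v. v \<in> (\<lambda>x. \<Sum>t=1..T. f t x) ` \<Theta>)"

end

theory Submission imports Defs begin

text \<open>
  Write \<open>D t\<close> for the expected squared distance from the iterate \<open>x\<^sub>t\<close> to a minimiser \<open>y\<close> of the
  total loss. The projection is nonexpansive, so a single step that moves along block \<open>p\<close> satisfies
  \<open>|x\<^sub>t\<^sub>+\<^sub>1 - y|\<^sup>2 \<le> |x\<^sub>t - y|\<^sup>2 - 2 \<alpha>\<^sub>t (U\<^sub>p \<nabla>f\<^sub>t(x\<^sub>t)) \<bullet> (x\<^sub>t - y) + \<alpha>\<^sub>t\<^sup>2 |U\<^sub>p \<nabla>f\<^sub>t(x\<^sub>t)|\<^sup>2\<close>.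
  Averaged over \<open>p\<close>, the blocks of the gradient reassemble both in the inner product and in the
  squared norm (\<open>sum_projected_block_steps\<close>): the average step is a full gradient step slowed down
  by the factor \<open>P\<close>. Strong convexity bounds the inner product from below by
  \<open>f\<^sub>t(x\<^sub>t) - f\<^sub>t(y) + \<mu>/2 |x\<^sub>t - y|\<^sup>2\<close>, and with \<open>\<alpha>\<^sub>t = P / (\<mu> t)\<close> one obtains
  (\<open>loss_gap_le_potential_drop\<close>)
  \<open>f\<^sub>t(x\<^sub>t) - f\<^sub>t(y) \<le> \<mu>/2 ((t - 1) |x\<^sub>t - y|\<^sup>2 - t A\<^sub>t) + P G\<^sup>2 / (2 \<mu> t)\<close>,
  where \<open>A\<^sub>t\<close> is the average of \<open>|x\<^sub>t\<^sub>+\<^sub>1 - y|\<^sup>2\<close> over the block selected at time \<open>t\<close>.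

  The iterate \<open>x\<^sub>t\<close> depends only on the selections before time \<open>t\<close>, which are independent of the
  selection at time \<open>t\<close>; hence the expectation of \<open>A\<^sub>t\<close> is \<open>D (t + 1)\<close>
  (\<open>expectation_average_over_uniform\<close>). In expectation the brackets thus telescope to
  \<open>- T D (T + 1) \<le> 0\<close>, and the remaining terms add up to a harmonic sum, which is at most
  \<open>1 + ln T\<close>.
\<close>

section \<open>Existence of the offline minimiser\<close>

text \<open>
  The quadratic lower bound exceeds the value at \<open>x0\<close> outside the ball of radius \<open>|v| / c\<close> around
  \<open>x0\<close>, so that only a compact part of \<open>S\<close> matters.
\<close>

lemma quadratic_minorant_attains_min:
  fixes F :: "'a::euclidean_space \<Rightarrow> real"
  assumes cont: "continuous_on S F" and S: "closed S" "x0 \<in> S" and c: "c > 0"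
    and minorant: "\<And>y. y \<in> S \<Longrightarrow> F y \<ge> F x0 + v \<bullet> (y - x0) + c * (norm (y - x0))\<^sup>2"
  obtains y where "y \<in> S" "\<And>z. z \<in> S \<Longrightarrow> F y \<le> F z"
proof -
  define K where "K = S \<inter> cball x0 (norm v / c)"
  have "compact K" and "x0 \<in> K"
    using S c by (auto simp: K_def closed_Int_compact)
  moreover have "continuous_on K F"
    by (rule continuous_on_subset[OF cont]) (auto simp: K_def)
  ultimately obtain y where y: "y \<in> K" "\<And>z. z \<in> K \<Longrightarrow> F y \<le> F z"
    using continuous_attains_inf[of K F] by auto
  have "F y \<le> F z" if z: "z \<in> S" for z
  proof (cases "z \<in> K")
    case False
    then have "norm v / c < norm (z - x0)"
      using z by (simp add: K_def dist_norm norm_minus_commute)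
    then have "norm v \<le> c * norm (z - x0)"
      using c by (simp add: field_simps)
    then have "norm v * norm (z - x0) \<le> c * norm (z - x0) * norm (z - x0)"
      by (rule mult_right_mono) simp
    moreover have "- (norm v * norm (z - x0)) \<le> v \<bullet> (z - x0)"
      using Cauchy_Schwarz_ineq2[of v "z - x0"] by linarith
    ultimately have "F x0 \<le> F z"
      using minorant[OF z] by (simp add: power2_eq_square algebra_simps)
    then show ?thesis
      using y(2)[OF \<open>x0 \<in> K\<close>] by linarith
  qed (rule y(2))
  then show thesis
    using y(1) that by (auto simp: K_def)
qed

section \<open>The average over the blocks of one projected step\<close>

lemma block_selector_nth: "(block_selector blk p *v h) $ k = (if blk k = p then h $ k else 0)"
proof -
  have "(block_selector blk p *v h) $ k = (\<Sum>j\<in>UNIV. if k = j then (if blk k = p then h $ j else 0) else 0)"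
    unfolding block_selector_def matrix_vector_mult_def vec_lambda_beta by (intro sum.cong) auto
  then show ?thesis by simp
qed

lemma sum_block_selector_inner:
  assumes "\<And>k. blk k \<in> {1..P}"
  shows "(\<Sum>p=1..P. (block_selector blk p *v h) \<bullet> v) = h \<bullet> v"
proof -
  have "(\<Sum>p=1..P. (block_selector blk p *v h) \<bullet> v)
      = (\<Sum>p=1..P. \<Sum>k\<in>UNIV. if blk k = p then h $ k * v $ k else 0)"
    unfolding inner_vec_def by (intro sum.cong) (auto simp: block_selector_nth)
  also have "\<dots> = (\<Sum>k\<in>UNIV. \<Sum>p=1..P. if blk k = p then h $ k * v $ k else 0)"
    by (rule sum.swap)
  also have "\<dots> = h \<bullet> v"
    using assms by (simp add: inner_vec_def)
  finally show ?thesis .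
qed

lemma sum_block_selector_norm:
  assumes "\<And>k. blk k \<in> {1..P}"
  shows "(\<Sum>p=1..P. (norm (block_selector blk p *v h))\<^sup>2) = (norm h)\<^sup>2"
proof -
  have "(norm (block_selector blk p *v h))\<^sup>2 = (block_selector blk p *v h) \<bullet> h" for p
    unfolding power2_norm_eq_inner inner_vec_def by (intro sum.cong) (auto simp: block_selector_nth)
  then show ?thesis
    using sum_block_selector_inner[where blk=blk and h=h and v=h, OF assms] by (simp add: power2_norm_eq_inner)
qed

lemma projected_step_distance:
  fixes \<Theta> :: "'a::euclidean_space set"
  assumes \<Theta>: "closed \<Theta>" "convex \<Theta>" and y: "y \<in> \<Theta>"
  shows "(norm (closest_point \<Theta> (x - a *\<^sub>R u) - y))\<^sup>2
    \<le> (norm (x - y))\<^sup>2 - 2 * a * (u \<bullet> (x - y)) + a\<^sup>2 * (norm u)\<^sup>2"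
proof -
  have "norm (closest_point \<Theta> (x - a *\<^sub>R u) - y) \<le> norm (x - a *\<^sub>R u - y)"
    using closest_point_lipschitz[of \<Theta> "x - a *\<^sub>R u" y] \<Theta> y closest_point_self[OF y]
    by (auto simp: dist_norm)
  then have "(norm (closest_point \<Theta> (x - a *\<^sub>R u) - y))\<^sup>2 \<le> (norm (x - a *\<^sub>R u - y))\<^sup>2"
    by (simp add: power_mono)
  also have "\<dots> = (norm (x - y))\<^sup>2 - 2 * a * (u \<bullet> (x - y)) + a\<^sup>2 * (norm u)\<^sup>2"
    unfolding power2_norm_eq_inner
    by (simp add: inner_diff_left inner_diff_right inner_commute algebra_simps power2_eq_square)
  finally show ?thesis .
qed

text \<open>
  Summed over all blocks, the progress and the error terms are those of one full gradient step,
  whereas the squared distance to \<open>y\<close> is counted \<open>P\<close> times.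
\<close>

lemma sum_projected_block_steps:
  assumes "closed \<Theta>" "convex \<Theta>" "y \<in> \<Theta>" and blocks: "\<And>k. blk k \<in> {1..P}"
  shows "(\<Sum>p=1..P. (norm (closest_point \<Theta> (x - a *\<^sub>R (block_selector blk p *v h)) - y))\<^sup>2)
    \<le> real P * (norm (x - y))\<^sup>2 - 2 * a * (h \<bullet> (x - y)) + a\<^sup>2 * (norm h)\<^sup>2"
proof -
  have "(\<Sum>p=1..P. (norm (closest_point \<Theta> (x - a *\<^sub>R (block_selector blk p *v h)) - y))\<^sup>2)
    \<le> (\<Sum>p=1..P. (norm (x - y))\<^sup>2 - 2 * a * ((block_selector blk p *v h) \<bullet> (x - y))
        + a\<^sup>2 * (norm (block_selector blk p *v h))\<^sup>2)"
    using assms by (intro sum_mono projected_step_distance) auto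
  also have "\<dots> = real P * (norm (x - y))\<^sup>2 - 2 * a * (h \<bullet> (x - y)) + a\<^sup>2 * (norm h)\<^sup>2"
    by (simp add: sum.distrib sum_subtractf sum_block_selector_inner[where blk=blk, OF blocks]
        sum_block_selector_norm[where blk=blk, OF blocks] del: One_nat_def flip: sum_distrib_left)
  finally show ?thesis .
qed

text \<open>
  The stepsize is chosen so that strong convexity lowers the weight \<open>t\<close> of the old squared distance
  to \<open>t - 1\<close>: this is the weight which the new squared distance received one step earlier, and
  the resulting bounds telescope.
\<close>

lemma loss_gap_le_potential_drop:
  fixes h :: "real ^ 'n::finite"
  assumes \<Theta>: "closed \<Theta>" "convex \<Theta>" "y \<in> \<Theta>" and blocks: "\<And>k. blk k \<in> {1..P}"
    and \<mu>: "\<mu> > 0" and t: "t > 0" and a: "a = real P / (\<mu> * t)" and G: "norm h \<le> G"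
    and gap: "\<delta> \<le> h \<bullet> (x - y) - \<mu> / 2 * (norm (x - y))\<^sup>2"
  shows "\<delta> \<le> \<mu> / 2 * ((t - 1) * (norm (x - y))\<^sup>2
      - t * ((\<Sum>p=1..P. (norm (closest_point \<Theta> (x - a *\<^sub>R (block_selector blk p *v h)) - y))\<^sup>2)
          / real P))
    + real P * G\<^sup>2 / (2 * \<mu>) * (1 / t)"
proof -
  define S where "S = (\<Sum>p=1..P. (norm (closest_point \<Theta> (x - a *\<^sub>R (block_selector blk p *v h)) - y))\<^sup>2)"
  have P: "real P > 0"
    using blocks[of undefined] by auto
  have "a\<^sup>2 * (norm h)\<^sup>2 \<le> a\<^sup>2 * G\<^sup>2"
    using G by (intro mult_left_mono power_mono) auto
  then have "S \<le> real P * (norm (x - y))\<^sup>2 - 2 * a * (h \<bullet> (x - y)) + a\<^sup>2 * G\<^sup>2"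
    using sum_projected_block_steps[where blk=blk and x=x and a=a and h=h, OF \<Theta> blocks] unfolding S_def by linarith
  then have "\<mu> * t / (2 * real P) * S
      \<le> \<mu> * t / (2 * real P) * (real P * (norm (x - y))\<^sup>2 - 2 * a * (h \<bullet> (x - y)) + a\<^sup>2 * G\<^sup>2)"
    using P \<mu> t by (intro mult_left_mono) auto
  also have "\<dots> = \<mu> * t / 2 * (norm (x - y))\<^sup>2 - h \<bullet> (x - y) + real P * G\<^sup>2 / (2 * \<mu>) * (1 / t)"
    using P \<mu> t unfolding a by (simp add: field_simps power2_eq_square)
  finally have "h \<bullet> (x - y) \<le> \<mu> * t / 2 * (norm (x - y))\<^sup>2 - \<mu> / 2 * (t * (S / real P))
      + real P * G\<^sup>2 / (2 * \<mu>) * (1 / t)"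
    by (simp add: mult_ac)
  with gap show ?thesis
    unfolding S_def[symmetric] by (simp add: algebra_simps)
qed

section \<open>Iterates and the history of selections\<close>

lemma orcd_in_feasible_set:
  assumes "closed \<Theta>" "x0 \<in> \<Theta>"
  shows "orcd \<Theta> blk \<alpha> g x0 s t \<in> \<Theta>"
  using assms by (cases t) (auto intro: closest_point_in_set)

lemma orcd_depends_on_past:
  assumes "\<And>i. i < t \<Longrightarrow> s i = s' i"
  shows "orcd \<Theta> blk \<alpha> g x0 s t = orcd \<Theta> blk \<alpha> g x0 s' t"
  using assms by (induction t) simp_all

text \<open>
  The range of \<open>H\<close> carries the discrete \<open>\<sigma>\<close>-algebra, so \<open>\<phi>\<close> is measurable on it, and a finite range
  makes \<open>\<phi> H\<close> bounded.
\<close>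

lemma (in finite_measure) integrable_finite_range:
  fixes \<phi> :: "'b \<Rightarrow> real"
  assumes H: "H \<in> measurable M (count_space A)" and A: "finite A"
  shows "integrable M (\<lambda>\<omega>. \<phi> (H \<omega>))"
proof (rule integrable_const_bound[where B="\<Sum>z\<in>A. \<bar>\<phi> z\<bar>"])
  have "\<bar>\<phi> (H \<omega>)\<bar> \<le> (\<Sum>z\<in>A. \<bar>\<phi> z\<bar>)" if "\<omega> \<in> space M" for \<omega>
    using measurable_space[OF H that] A by (intro member_le_sum) auto
  then show "AE \<omega> in M. norm (\<phi> (H \<omega>)) \<le> (\<Sum>z\<in>A. \<bar>\<phi> z\<bar>)"
    by simp
  show "(\<lambda>\<omega>. \<phi> (H \<omega>)) \<in> borel_measurable M"
    by (rule measurable_compose[OF H]) simp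
qed

text \<open>
  This replaces conditioning on the history \<open>H\<close>: splitting by the value \<open>p\<close> of \<open>\<sigma> K\<close>, the indicator
  of \<open>\<sigma> K = p\<close> is independent of \<open>\<psi> H p\<close>, so its expectation \<open>1 / P\<close> factors out. The uniform
  variable is given as a function \<open>\<sigma>\<close> of \<open>K\<close>, because \<^const>\<open>prob_space.indep_var\<close> relates two
  random variables with values in the same type.
\<close>

lemma (in prob_space) expectation_average_over_uniform:
  fixes \<psi> :: "'b \<Rightarrow> nat \<Rightarrow> real"
  assumes indep: "indep_var (count_space A) H (count_space B) K" and A: "finite A"
    and \<sigma>: "\<sigma> \<in> B \<rightarrow> {1..P}"
    and uniform: "\<And>p. p \<in> {1..P} \<Longrightarrow> prob {\<omega> \<in> space M. \<sigma> (K \<omega>) = p} = 1 / real P"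
  shows "expectation (\<lambda>\<omega>. \<psi> (H \<omega>) (\<sigma> (K \<omega>)))
    = expectation (\<lambda>\<omega>. (\<Sum>p=1..P. \<psi> (H \<omega>) p) / real P)"
proof -
  define S where "S \<omega> = \<sigma> (K \<omega>)" for \<omega>
  have H: "H \<in> measurable M (count_space A)" and K: "K \<in> measurable M (count_space B)"
    using indep by (auto dest: indep_var_rv1 indep_var_rv2)
  have S: "S \<in> measurable M (count_space {1..P})"
    unfolding S_def using \<sigma> by (intro measurable_compose[OF K]) auto
  have int: "integrable M (\<lambda>\<omega>. \<psi> (H \<omega>) p)"
    and int_ind: "integrable M (\<lambda>\<omega>. if S \<omega> = p then 1 else 0 :: real)" for p
    by (rule integrable_finite_range[OF H A, where \<phi>="\<lambda>z. \<psi> z p"])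
       (rule integrable_finite_range[OF S, where \<phi>="\<lambda>q. if q = p then 1 else 0"], simp)
  have ind: "indep_var borel (\<lambda>\<omega>. \<psi> (H \<omega>) p) borel (\<lambda>\<omega>. if S \<omega> = p then 1 else 0 :: real)" for p
    using indep_var_compose[OF indep, of "\<lambda>z. \<psi> z p" borel
        "\<lambda>z. if \<sigma> z = p then 1 else 0 :: real" borel]
    by (simp add: comp_def S_def)
  have prob: "expectation (\<lambda>\<omega>. if S \<omega> = p then 1 else 0) = 1 / real P" if p: "p \<in> {1..P}" for p
  proof -
    have "expectation (\<lambda>\<omega>. if S \<omega> = p then 1 else 0)
        = expectation (indicator {\<omega> \<in> space M. S \<omega> = p})"
      by (intro Bochner_Integration.integral_cong) (auto simp: indicator_def)
    also have "{\<omega> \<in> space M. S \<omega> = p} = S -` {p} \<inter> space M"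
      by auto
    also have "expectation (indicator \<dots>) = prob (S -` {p} \<inter> space M)"
      by simp
    also have "S -` {p} \<inter> space M = {\<omega> \<in> space M. S \<omega> = p}"
      by auto
    finally show ?thesis using uniform[OF p] by (simp add: S_def)
  qed
  have "expectation (\<lambda>\<omega>. \<psi> (H \<omega>) (S \<omega>))
      = expectation (\<lambda>\<omega>. \<Sum>p=1..P. \<psi> (H \<omega>) p * (if S \<omega> = p then 1 else 0))"
  proof (intro Bochner_Integration.integral_cong refl)
    fix \<omega> assume "\<omega> \<in> space M"
    then have "S \<omega> \<in> {1..P}"
      using measurable_space[OF S] by auto
    then show "\<psi> (H \<omega>) (S \<omega>) = (\<Sum>p=1..P. \<psi> (H \<omega>) p * (if S \<omega> = p then 1 else 0))"
      by (simp add: if_distrib[of "\<lambda>z. _ * z"] cong: if_cong)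
  qed
  also have "\<dots> = (\<Sum>p=1..P. expectation (\<lambda>\<omega>. \<psi> (H \<omega>) p * (if S \<omega> = p then 1 else 0)))"
    by (intro Bochner_Integration.integral_sum indep_var_integrable ind int int_ind)
  also have "\<dots> = (\<Sum>p=1..P. expectation (\<lambda>\<omega>. \<psi> (H \<omega>) p) * (1 / real P))"
    by (intro sum.cong refl) (simp only: indep_var_lebesgue_integral[OF ind int int_ind] prob)
  also have "\<dots> = expectation (\<lambda>\<omega>. (\<Sum>p=1..P. \<psi> (H \<omega>) p) / real P)"
    using int by (simp add: sum_divide_distrib)
  finally show ?thesis
    by (simp add: S_def)
qed

lemma (in prob_space) past_indep_present:
  fixes sel :: "nat \<Rightarrow> 'a \<Rightarrow> nat"
  assumes "indep_vars (\<lambda>_. count_space {1..P}) sel UNIV"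
  shows "indep_var
    (count_space (PiE {..<t} (\<lambda>_. {1..P}))) (\<lambda>\<omega>. restrict (\<lambda>i. sel i \<omega>) {..<t})
    (count_space (PiE {t} (\<lambda>_. {1..P}))) (\<lambda>\<omega>. restrict (\<lambda>i. sel i \<omega>) {t})"
proof -
  have "PiM I (\<lambda>_. count_space {1..P}) = count_space (PiE I (\<lambda>_. {1..P}))"
    if "finite I" for I :: "nat set"
    using that by (rule count_space_PiM_finite) auto
  then show ?thesis
    using indep_var_restrict[OF assms, of "{..<t}" "{t}"] by simp
qed

section \<open>Summing the steps\<close>

text \<open>
  The sum telescopes to \<open>- T d (T + 1)\<close>: the weight of \<open>d 1\<close> is zero, so no initial distance is
  left over.
\<close>

lemma sum_potential_drop_nonpos:
  fixes d :: "nat \<Rightarrow> real"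
  assumes "d (Suc T) \<ge> 0"
  shows "(\<Sum>t=1..T. (real t - 1) * d t - real t * d (Suc t)) \<le> 0"
proof -
  have "(\<Sum>t=1..T. (real t - 1) * d t - real t * d (Suc t)) = - (real T * d (Suc T))"
    by (induction T) (simp_all add: algebra_simps)
  then show ?thesis using assms by simp
qed

lemma sum_inverse_le_ln:
  assumes "T \<ge> 1"
  shows "(\<Sum>t=1..T. 1 / real t) \<le> 1 + ln (real T)"
  using euler_mascheroni_sequence_decreasing[of 1 T] assms by (simp add: harm_def inverse_eq_divide)


theorem theorem2:
  fixes f :: "nat \<Rightarrow> real ^ 'n::finite \<Rightarrow> real"
    and g :: "nat \<Rightarrow> real ^ 'n \<Rightarrow> real ^ 'n"
    and \<Theta> :: "(real ^ 'n) set"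
    and blk :: "'n \<Rightarrow> nat"
    and P T :: nat
    and M :: "'w measure"
    and sel :: "nat \<Rightarrow> 'w \<Rightarrow> nat"
    and \<alpha> :: "nat \<Rightarrow> real"
    and x0 :: "real ^ 'n"
    and G \<mu> :: real
  assumes convex_f: "\<And>t. convex_on UNIV (f t)"
    and gradient: "\<And>t x. GDERIV (f t) x :> g t x"
    and gradient_continuous: "\<And>t. continuous_on UNIV (g t)"
    and \<Theta>: "\<Theta> \<noteq> {}" "closed \<Theta>" "convex \<Theta>"
    and blocks: "\<And>k. blk k \<in> {1..P}"
    and M: "prob_space M"
    and sel_indep: "prob_space.indep_vars M (\<lambda>_. count_space {1..P}) sel UNIV"
    and sel_uniform:
      "\<And>t p. p \<in> {1..P} \<Longrightarrow> measure M {\<omega> \<in> space M. sel t \<omega> = p} = 1 / real P"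
    and x0: "x0 \<in> \<Theta>"
    and gradient_bounded: "\<And>t x. t \<ge> 1 \<Longrightarrow> x \<in> \<Theta> \<Longrightarrow> norm (g t x) \<le> G"
    and \<mu>: "\<mu> > 0"
    and strongly_convex:
      "\<And>t x y. f t y \<ge> f t x + g t x \<bullet> (y - x) + \<mu> / 2 * (norm (y - x))\<^sup>2"
    and stepsize_0: "\<alpha> 0 > 0"
    and stepsize: "\<And>t. t \<ge> 1 \<Longrightarrow> \<alpha> t = real P / (\<mu> * real t)"
    and T: "T \<ge> 1"
  shows "static_regret M f \<Theta> (\<lambda>t \<omega>. orcd \<Theta> blk \<alpha> g x0 (\<lambda>t. sel t \<omega>) t) T
    \<le> real P * G\<^sup>2 / (2 * \<mu>) * (1 + ln (real T))"
proof -
  interpret prob_space M by (fact M)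
  let ?F = "\<lambda>x. \<Sum>t=1..T. f t x"
  define X where "X t \<omega> = orcd \<Theta> blk \<alpha> g x0 (\<lambda>t. sel t \<omega>) t" for t \<omega>

  have "isCont (f t) x" for t x
    using gradient[of t x] unfolding gderiv_def by (rule has_derivative_continuous)
  then have cont: "continuous_on \<Theta> ?F"
    by (intro continuous_on_sum continuous_at_imp_continuous_on) auto
  have minorant: "?F y \<ge> ?F x0 + (\<Sum>t=1..T. g t x0) \<bullet> (y - x0)
      + (real T * (\<mu> / 2)) * (norm (y - x0))\<^sup>2" for y
    using sum_mono[of "{1..T}" "\<lambda>t. f t x0 + g t x0 \<bullet> (y - x0) + \<mu> / 2 * (norm (y - x0))\<^sup>2"
        "\<lambda>t. f t y", OF strongly_convex]
    by (simp add: sum.distrib inner_sum_left)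
  obtain y where y: "y \<in> \<Theta>" "\<And>z. z \<in> \<Theta> \<Longrightarrow> ?F y \<le> ?F z"
    using quadratic_minorant_attains_min[OF cont \<Theta>(2) x0 _ minorant] \<mu> T by auto
  have min: "(LEAST v. v \<in> ?F ` \<Theta>) = ?F y"
    using y by (intro Least_equality) auto

  \<comment> \<open>The iterate at time \<open>t\<close> factors through the finite-valued history \<open>H t\<close> of earlier selections.
    This gives integrability of all its functions and independence of the current selection.\<close>
  define A where "A t = PiE {..<t} (\<lambda>_::nat. {1..P})" for t
  define H where "H t \<omega> = restrict (\<lambda>i. sel i \<omega>) {..<t}" for t \<omega>
  have A: "finite (A t)" for t
    unfolding A_def by (intro finite_PiE) auto
  have indep: "indep_var (count_space (A t)) (H t)
      (count_space (PiE {t} (\<lambda>_. {1..P}))) (\<lambda>\<omega>. restrict (\<lambda>i. sel i \<omega>) {t})" for t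
    using past_indep_present[OF sel_indep] unfolding A_def H_def .
  have X: "X t \<omega> = orcd \<Theta> blk \<alpha> g x0 (H t \<omega>) t" for t \<omega>
    unfolding X_def H_def by (rule orcd_depends_on_past) simp
  have int: "integrable M (\<lambda>\<omega>. \<phi> (X t \<omega>))" for \<phi> :: "real ^ 'n \<Rightarrow> real" and t
    unfolding X
    by (rule integrable_finite_range[OF indep_var_rv1[OF indep] A,
          where \<phi>="\<lambda>s. \<phi> (orcd \<Theta> blk \<alpha> g x0 s t)"])

  define D where "D t = expectation (\<lambda>\<omega>. (norm (X t \<omega> - y))\<^sup>2)" for t
  define avg where "avg t x = (\<Sum>p=1..P.
      (norm (closest_point \<Theta> (x - \<alpha> t *\<^sub>R (block_selector blk p *v g t x)) - y))\<^sup>2) / real P" for t x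
  have D_Suc: "D (Suc t) = expectation (\<lambda>\<omega>. avg t (X t \<omega>))" for t
  proof -
    have "X (Suc t) \<omega> = closest_point \<Theta>
        (X t \<omega> - \<alpha> t *\<^sub>R (block_selector blk (sel t \<omega>) *v g t (X t \<omega>)))" for \<omega>
      by (simp add: X_def)
    then show ?thesis
      unfolding D_def avg_def X[of t]
      using sel_uniform expectation_average_over_uniform[OF indep[of t] A, where \<sigma>="\<lambda>s. s t" and P=P
          and \<psi>="\<lambda>s p. (norm (closest_point \<Theta> (orcd \<Theta> blk \<alpha> g x0 s t
            - \<alpha> t *\<^sub>R (block_selector blk p *v g t (orcd \<Theta> blk \<alpha> g x0 s t))) - y))\<^sup>2"]
      by auto
  qed

  have step: "expectation (\<lambda>\<omega>. f t (X t \<omega>)) - f t y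
      \<le> \<mu> / 2 * ((real t - 1) * D t - real t * D (Suc t))
        + real P * G\<^sup>2 / (2 * \<mu>) * (1 / real t)" if t: "t \<ge> 1" for t
  proof -
    have pointwise: "f t x - f t y
      \<le> \<mu> / 2 * ((real t - 1) * (norm (x - y))\<^sup>2 - real t * avg t x)
        + real P * G\<^sup>2 / (2 * \<mu>) * (1 / real t)" if x: "x \<in> \<Theta>" for x
      unfolding avg_def
    proof (rule loss_gap_le_potential_drop)
      show "f t x - f t y \<le> g t x \<bullet> (x - y) - \<mu> / 2 * (norm (x - y))\<^sup>2"
        using strongly_convex[of t x y]
        by (simp add: norm_minus_commute inner_diff_right algebra_simps)
    qed (use \<Theta> y blocks \<mu> t stepsize gradient_bounded x in auto)
    have "expectation (\<lambda>\<omega>. f t (X t \<omega>) - f t y)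
      \<le> expectation (\<lambda>\<omega>. \<mu> / 2 * ((real t - 1) * (norm (X t \<omega> - y))\<^sup>2 - real t * avg t (X t \<omega>))
        + real P * G\<^sup>2 / (2 * \<mu>) * (1 / real t))"
      by (intro integral_mono int[of "\<lambda>x. f t x - f t y"] pointwise
          int[of "\<lambda>x. \<mu> / 2 * ((real t - 1) * (norm (x - y))\<^sup>2 - real t * avg t x)
            + real P * G\<^sup>2 / (2 * \<mu>) * (1 / real t)"])
        (simp add: X_def orcd_in_feasible_set \<Theta> x0)
    also have "\<dots> = \<mu> / 2 * ((real t - 1) * D t - real t * D (Suc t))
        + real P * G\<^sup>2 / (2 * \<mu>) * (1 / real t)"
      using int[of "\<lambda>x. (norm (x - y))\<^sup>2" t] int[of "avg t" t]
      by (simp add: D_Suc D_def[of t] prob_space)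
    finally show ?thesis
      using int[of "f t" t] by (simp add: prob_space)
  qed

  have "static_regret M f \<Theta> X T
      = (\<Sum>t=1..T. expectation (\<lambda>\<omega>. f t (X t \<omega>)) - f t y)"
    unfolding static_regret_def min by (simp add: sum_subtractf)
  also have "\<dots> \<le> (\<Sum>t=1..T. \<mu> / 2 * ((real t - 1) * D t - real t * D (Suc t))
      + real P * G\<^sup>2 / (2 * \<mu>) * (1 / real t))"
    by (intro sum_mono step) auto
  also have "\<dots> = \<mu> / 2 * (\<Sum>t=1..T. (real t - 1) * D t - real t * D (Suc t))
      + real P * G\<^sup>2 / (2 * \<mu>) * (\<Sum>t=1..T. 1 / real t)"
    by (simp only: sum.distrib sum_distrib_left)
  also have "\<dots> \<le> 0 + real P * G\<^sup>2 / (2 * \<mu>) * (1 + ln (real T))"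
  proof (intro add_mono mult_left_mono)
    have "D (Suc T) \<ge> 0"
      unfolding D_def by simp
    then show "\<mu> / 2 * (\<Sum>t=1..T. (real t - 1) * D t - real t * D (Suc t)) \<le> 0"
      using \<mu> sum_potential_drop_nonpos by (intro mult_nonneg_nonpos) auto
  qed (use \<mu> T sum_inverse_le_ln in auto)
  finally show ?thesis
    by (simp add: X_def[abs_def])
qed

end
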